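(* Let $\mathcal H$ be a real Hilbert space, $1\le p<2$, $\mathcal J:\mathcal H\to\mathbb R\cup\{+\infty\}$ absolutely $p$-homogeneous, proper, convex and lower semicontinuous, and let $u$ be the gradient flow of $\mathcal J$ with initial datum $f\in\overline{\mathrm{dom}(\mathcal J)}$ and limit $u_\infty$. Assume that the extinction time satisfies $T_{\mathrm{ex}}<\infty$. Then for all $0<t<T_{\mathrm{ex}}$, $$(2-p)\lambda_1(T_{\mathrm{ex}}-t)\le\|u(t)-u_\infty\|^{2-p}\le(2-p)\Lambda(t)(T_{\mathrm{ex}}-t),$$ where $\Lambda(t):=\frac{p\mathcal J(u(t))}{\|u(t)-u_\infty\|^p}$.
   Context: $\mathcal J$ is absolutely $p$-homogeneous if $\mathcal J(0)=0$ and $\mathcal J(cu)=|c|^p\mathcal J(u)$ for $c\ne0$; $\mathrm{dom}(\mathcal J)=\{\mathcal J<\infty\}$; $\partial\mathcal J$ is the convex subdifferential. The null space $\mathcal N_{\mathcal J}=\{\mathcal J=0\}$ is a closed linear subspace and $\lambda_1:=\inf_{v\in\mathcal N_{\mathcal J}^\perp\setminus\{0\}}\frac{p\mathcal J(v)}{\|v\|^p}$. The gradient flow with initial datum $f\in\overline{\mathrm{dom}(\mathcal J)}$ is the unique continuous map $u:[0,\infty)\to\mathcal H$ with $u(0)=f$, Lipschitz on $[\delta,\infty)$ for all $\delta>0$, right-differentiable on $(0,\infty)$, with $-\partial_t^+u(t)$ equal to the minimal-norm element of $\partial\mathcal J(u(t))$ for all $t>0$. The limit $u_\infty:=\lim_{t\to\infty}u(t)$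 exists and equals the orthogonal projection of $f$ onto $\mathcal N_{\mathcal J}$. The extinction time is $T_{\mathrm{ex}}:=\inf\{t>0:u(t)=u_\infty\}\in[0,\infty]$. *)

theory Defs
  imports "HOL-Analysis.Analysis"
begin

text \<open>
  Functionals with values in \<open>\<real> \<union> {+\<infinity>}\<close> are represented as functions into \<^typ>\<open>ereal\<close> that never
  take the value \<open>-\<infinity>\<close>; the latter is part of \<open>proper_functional\<close>.
\<close>

definition proper_functional :: "('a \<Rightarrow> ereal) \<Rightarrow> bool" where
  "proper_functional J \<longleftrightarrow> (\<forall>x. J x \<noteq> -\<infinity>) \<and> (\<exists>x. J x \<noteq> \<infinity>)"

definition convex_functional :: "('a::real_vector \<Rightarrow> ereal) \<Rightarrow> bool" where
  "convex_functional J \<longleftrightarrow>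
    (\<forall>x y. \<forall>s\<ge>0. \<forall>t\<ge>0. s + t = 1 \<longrightarrow>
      J (s *\<^sub>R x + t *\<^sub>R y) \<le> ereal s * J x + ereal t * J y)"

definition lsc_functional :: "('a::topological_space \<Rightarrow> ereal) \<Rightarrow> bool" where
  "lsc_functional J \<longleftrightarrow> (\<forall>x. J x \<le> Liminf (at x) J)"

definition abs_homogeneous :: "real \<Rightarrow> ('a::real_vector \<Rightarrow> ereal) \<Rightarrow> bool" where
  "abs_homogeneous p J \<longleftrightarrow>
    J 0 = 0 \<and> (\<forall>c u. c \<noteq> 0 \<longrightarrow> J (c *\<^sub>R u) = ereal (\<bar>c\<bar> powr p) * J u)"

definition effective_dom :: "('a \<Rightarrow> ereal) \<Rightarrow> 'a set" where
  "effective_dom J = {u. J u < \<infinity>}"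

text \<open>For proper \<open>J\<close> this set is empty at every \<open>u\<close> outside the effective domain.\<close>

definition subdifferential :: "('a::real_inner \<Rightarrow> ereal) \<Rightarrow> 'a \<Rightarrow> 'a set" where
  "subdifferential J u = {\<zeta>. \<forall>v. J u + ereal (\<zeta> \<bullet> (v - u)) \<le> J v}"

definition null_space_of :: "('a \<Rightarrow> ereal) \<Rightarrow> 'a set" where
  "null_space_of J = {u. J u = 0}"

text \<open>The value is \<open>\<infinity>\<close> if the infimum is over the empty set or if \<open>J\<close> is infinite on all of it.\<close>

definition lambda1 :: "real \<Rightarrow> ('a::real_inner \<Rightarrow> ereal) \<Rightarrow> ereal" where
  "lambda1 p J =
    (INF v \<in> (null_space_of J)\<^sup>\<bottom> - {0}. ereal p * J v / ereal (norm v powr p))"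

definition is_min_norm_element :: "'a::real_normed_vector \<Rightarrow> 'a set \<Rightarrow> bool" where
  "is_min_norm_element \<zeta> S \<longleftrightarrow> \<zeta> \<in> S \<and> (\<forall>\<eta>\<in>S. norm \<zeta> \<le> norm \<eta>)"

text \<open>Only the values \<open>u t\<close> for \<open>t \<ge> 0\<close> matter; \<open>u\<close> is unconstrained on the negative reals.\<close>

definition is_gradient_flow ::
  "('a::real_inner \<Rightarrow> ereal) \<Rightarrow> 'a \<Rightarrow> (real \<Rightarrow> 'a) \<Rightarrow> bool" where
  "is_gradient_flow J f u \<longleftrightarrow>
    u 0 = f \<and>
    continuous_on {0..} u \<and>
    (\<forall>\<delta>>0. \<exists>L. lipschitz_on L {\<delta>..} u) \<and>
    (\<forall>t>0. \<exists>u'. (u has_vector_derivative u') (at_right t) \<and>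
      is_min_norm_element (- u') (subdifferential J (u t)))"

definition extinction_time :: "(real \<Rightarrow> 'a) \<Rightarrow> 'a \<Rightarrow> ereal" where
  "extinction_time u u_inf = (INF t \<in> {t. 0 < t \<and> u t = u_inf}. ereal t)"

definition upper_Lambda ::
  "real \<Rightarrow> ('a::real_normed_vector \<Rightarrow> ereal) \<Rightarrow> (real \<Rightarrow> 'a) \<Rightarrow> 'a \<Rightarrow> real \<Rightarrow> ereal" where
  "upper_Lambda p J u u_inf t = ereal p * J (u t) / ereal (norm (u t - u_inf) powr p)"

end

theory Submission
  imports Defs
begin

text \<open>
  Write \<open>y\<close> for the limit, \<open>T\<close> for the extinction time, \<open>r t = norm (u t - y)\<close> and
  \<open>j t = J (u t)\<close>, and let \<open>- \<zeta> t\<close> be the right derivative of \<open>u\<close>, so that \<open>\<zeta> t\<close> is a subgradient.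
  Adding a null vector does not change \<open>J\<close>, whence subgradients are orthogonal to the null space
  (\<open>subgradient_orthogonal_null\<close>), and homogeneity gives Euler's identity \<open>\<zeta> t \<bullet> u t = p * j t\<close>
  (\<open>subgradient_euler\<close>). As \<open>u\<close> reaches its limit at the finite time \<open>T\<close> and its norm decreases
  strictly as long as \<open>j\<close> is positive, \<open>y = u T\<close> is a null vector (\<open>limit_attained_null\<close>). Together
  these facts say that \<open>r powr (2 - p)\<close> has right derivative \<open>- (2 - p) * \<Lambda>\<close> on \<open>(0, T)\<close>, where
  \<open>\<Lambda> t = p * j t / r t powr p\<close>, and it vanishes at \<open>T\<close>. The theorem is obtained by integrating two
  bounds on \<open>\<Lambda>\<close> over \<open>[t, T)\<close>.

  The bound \<open>\<lambda>\<^sub>1 \<le> \<Lambda>\<close> holds because \<open>u t - y\<close> is orthogonal to the null space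
  (\<open>lambda1_le_rayleigh\<close>). The upper bound by \<open>\<Lambda> t\<close> is the monotonicity of the Rayleigh quotient
  (\<open>rayleigh_antimono\<close>). It follows from \<open>p * j t = \<zeta> t \<bullet> (u t - y) \<le> norm (\<zeta> t) * r t\<close> if the energy
  \<open>j\<close> decays at least at the rate \<open>(norm (\<zeta> t))\<^sup>2\<close>. The usual derivation of this rate goes through the
  right continuity of \<open>\<zeta>\<close>. This is avoided by proving the decay only along some sequence of
  times decreasing to \<open>t\<close> (\<open>frequently_energy_decay\<close>). For a continuous function, control of this
  lower right Dini derivative is enough to conclude monotonicity (\<open>dini_antimono\<close>), and the same
  lemma replaces all integration.
\<close>

section \<open>Monotonicity from right derivatives\<close>

lemma eventually_right_derivative_bound:
  fixes F :: "real \<Rightarrow> real"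
  assumes "(F has_real_derivative D) (at_right x)" and "D < E"
  shows "\<forall>\<^sub>F s in at_right x. F s \<le> F x + E * (s - x)"
proof -
  have "((\<lambda>s. (F s - F x) / (s - x)) \<longlongrightarrow> D) (at_right x)"
    using assms(1) by (simp add: has_field_derivative_iff)
  then have "\<forall>\<^sub>F s in at_right x. (F s - F x) / (s - x) < E"
    using assms(2) by (rule order_tendstoD)
  moreover have "\<forall>\<^sub>F s in at_right x. x < s"
    by (simp add: eventually_at_right_less)
  ultimately show ?thesis
    by eventually_elim (simp add: field_simps)
qed

text \<open>
  By compactness there is a largest \<open>x\<close> in \<open>[a, b]\<close> with \<open>F x \<le> F a + \<epsilon> * (x - a)\<close>; if it were not
  \<open>b\<close>, the assumption would produce a larger one. The argument needs only points arbitrarily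
  close to \<open>x\<close>, not a whole right neighbourhood, and so covers the energy of the flow, of which only
  the lower right Dini derivative is controlled.
\<close>

lemma dini_antimono:
  fixes F :: "real \<Rightarrow> real"
  assumes "a \<le> b" and cont: "continuous_on {a..b} F"
    and dini: "\<And>x \<epsilon>. a \<le> x \<Longrightarrow> x < b \<Longrightarrow> 0 < \<epsilon> \<Longrightarrow>
      \<exists>\<^sub>F s in at_right x. F s \<le> F x + \<epsilon> * (s - x)"
  shows "F b \<le> F a"
proof (rule field_le_epsilon)
  fix e :: real assume "0 < e"
  define \<epsilon> where "\<epsilon> = e / (b - a + 1)"
  have eps: "0 < \<epsilon>" and small: "\<epsilon> * (b - a) \<le> e"
    using \<open>0 < e\<close> \<open>a \<le> b\<close> by (simp_all add: \<epsilon>_def field_simps)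
  define S where "S = {x \<in> {a..b}. F x - \<epsilon> * (x - a) \<le> F a}"
  have "S = {a..b} \<inter> (\<lambda>x. F x - \<epsilon> * (x - a)) -` {..F a}"
    by (auto simp: S_def)
  moreover have "closed ({a..b} \<inter> (\<lambda>x. F x - \<epsilon> * (x - a)) -` {..F a})"
    by (intro continuous_closed_preimage continuous_intros cont closed_atLeastAtMost closed_atMost)
  ultimately have "closed S"
    by simp
  moreover have "bounded S"
    by (rule bounded_subset[of "{a..b}"]) (auto simp: S_def)
  ultimately have "compact S"
    by (simp add: compact_eq_bounded_closed)
  moreover have "S \<noteq> {}"
    using \<open>a \<le> b\<close> by (auto simp: S_def)
  ultimately obtain c where c: "c \<in> S" and c_max: "\<And>x. x \<in> S \<Longrightarrow> x \<le> c"
    using compact_attains_sup[of S] by auto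
  have "c = b"
  proof (rule ccontr)
    assume "c \<noteq> b"
    then have "a \<le> c" "c < b" using c by (auto simp: S_def)
    have "\<forall>\<^sub>F s in at_right c. c < s \<and> s < b"
      using eventually_at_right_real[OF \<open>c < b\<close>] by simp
    with dini[OF \<open>a \<le> c\<close> \<open>c < b\<close> eps]
    have "\<exists>\<^sub>F s in at_right c. F s \<le> F c + \<epsilon> * (s - c) \<and> c < s \<and> s < b"
      by (rule frequently_eventually_frequently)
    then obtain s where s: "F s \<le> F c + \<epsilon> * (s - c)" "c < s" "s < b"
      by (auto dest: frequently_ex)
    have "s \<in> S"
      using s c by (auto simp: S_def algebra_simps)
    with c_max \<open>c < s\<close> show False by fastforce
  qed
  with c small show "F b \<le> F a + e"
    by (auto simp: S_def)
qed

corollary right_derivative_antimono: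
  fixes F :: "real \<Rightarrow> real"
  assumes "a \<le> b" and "continuous_on {a..b} F"
    and deriv: "\<And>x. a \<le> x \<Longrightarrow> x < b \<Longrightarrow>
      \<exists>D\<le>0. (F has_real_derivative D) (at_right x)"
  shows "F b \<le> F a"
proof (rule dini_antimono[OF assms(1,2)])
  fix x \<epsilon> :: real assume "a \<le> x" "x < b" "0 < \<epsilon>"
  then obtain D where D: "D \<le> 0" "(F has_real_derivative D) (at_right x)"
    using deriv by blast
  have "D < \<epsilon>"
    using D(1) \<open>0 < \<epsilon>\<close> by simp
  with D(2) have "\<forall>\<^sub>F s in at_right x. F s \<le> F x + \<epsilon> * (s - x)"
    by (rule eventually_right_derivative_bound)
  then show "\<exists>\<^sub>F s in at_right x. F s \<le> F x + \<epsilon> * (s - x)"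
    by (rule eventually_frequently[OF trivial_limit_at_right_real])
qed

lemma has_real_derivative_norm_sq_diff:
  fixes u :: "real \<Rightarrow> 'a::real_inner"
  assumes "(u has_vector_derivative d) (at t within S)"
  shows "((\<lambda>s. (norm (u s - y))\<^sup>2) has_real_derivative 2 * (d \<bullet> (u t - y))) (at t within S)"
proof -
  have u: "(u has_derivative (\<lambda>h. h *\<^sub>R d)) (at t within S)"
    using assms by (simp add: has_vector_derivative_def)
  have "((\<lambda>s. (u s - y) \<bullet> (u s - y)) has_derivative
      (\<lambda>h. (u t - y) \<bullet> (h *\<^sub>R d - 0) + (h *\<^sub>R d - 0) \<bullet> (u t - y))) (at t within S)"
    by (intro has_derivative_inner has_derivative_diff u has_derivative_const)
  moreover have "(\<lambda>h. (u t - y) \<bullet> (h *\<^sub>R d - 0) + (h *\<^sub>R d - 0) \<bullet> (u t - y))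
      = (*) (2 * (d \<bullet> (u t - y)))"
    by (auto simp: fun_eq_iff inner_commute)
  ultimately show ?thesis
    by (simp add: has_field_derivative_def power2_norm_eq_inner)
qed

lemma has_real_derivative_norm_diff_powr:
  fixes u :: "real \<Rightarrow> 'a::real_inner"
  assumes "(u has_vector_derivative d) (at t within S)" and "u t \<noteq> y"
  shows "((\<lambda>s. norm (u s - y) powr a) has_real_derivative
    a * norm (u t - y) powr (a - 2) * (d \<bullet> (u t - y))) (at t within S)"
proof -
  let ?n = "norm (u t - y)"
  have sq: "(n\<^sup>2) powr b = n powr (2 * b)" if "0 \<le> n" for n b :: real
  proof -
    have "n\<^sup>2 = n powr 2" using that by simp
    then have "(n\<^sup>2) powr b = (n powr 2) powr b" by (rule arg_cong)
    then show ?thesis unfolding powr_powr .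
  qed
  have "((\<lambda>x. x powr (a / 2)) has_real_derivative a / 2 * (?n\<^sup>2) powr (a / 2 - 1)) (at (?n\<^sup>2))"
    using assms(2) by (intro has_real_derivative_powr) simp
  from DERIV_chain2[OF this has_real_derivative_norm_sq_diff[OF assms(1)]]
  have "((\<lambda>s. ((norm (u s - y))\<^sup>2) powr (a / 2)) has_real_derivative
      a / 2 * (?n\<^sup>2) powr (a / 2 - 1) * (2 * (d \<bullet> (u t - y)))) (at t within S)" .
  moreover have "((norm (u s - y))\<^sup>2) powr (a / 2) = norm (u s - y) powr a" for s
    using sq[of "norm (u s - y)" "a / 2"] by simp
  moreover have "(?n\<^sup>2) powr (a / 2 - 1) = ?n powr (a - 2)"
    using sq[of ?n "a / 2 - 1"] by (simp add: right_diff_distrib)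
  ultimately show ?thesis
    by (simp add: mult.assoc)
qed

section \<open>Convex absolutely homogeneous functionals\<close>

locale homogeneous_convex =
  fixes J :: "'a::real_inner \<Rightarrow> ereal" and p :: real
  assumes hom: "abs_homogeneous p J" and conv: "convex_functional J"
begin

lemma J_zero: "J 0 = 0"
  and J_scale: "c \<noteq> 0 \<Longrightarrow> J (c *\<^sub>R v) = ereal (\<bar>c\<bar> powr p) * J v"
  using hom by (auto simp: abs_homogeneous_def)

lemma J_convex:
  "0 \<le> s \<Longrightarrow> 0 \<le> t \<Longrightarrow> s + t = 1 \<Longrightarrow> J (s *\<^sub>R x + t *\<^sub>R y) \<le> ereal s * J x + ereal t * J y"
  using conv by (auto simp: convex_functional_def)

lemma J_nonneg: "0 \<le> J v"
proof -
  have "J (- v) = J v"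
    using J_scale[of "-1" v] by simp
  then have "J 0 \<le> ereal (1/2) * J v + ereal (1/2) * J v"
    using J_convex[of "1/2" "1/2" v "- v"] by simp
  then show ?thesis
    by (cases "J v") (auto simp: J_zero)
qed

text \<open>
  Writing \<open>v + n = s *\<^sub>R (v /\<^sub>R s) + (1 - s) *\<^sub>R (n /\<^sub>R (1 - s))\<close> gives \<open>J (v + n) \<le> s powr (1 - p) * J v\<close>
  for every \<open>s\<close> in \<open>(0, 1)\<close>; now \<open>s \<rightarrow> 1\<close>.
\<close>

lemma J_add_null_le:
  assumes "J n = 0"
  shows "J (v + n) \<le> J v"
proof (cases "J v")
  case (real a)
  have le: "J (v + n) \<le> ereal (s * (inverse s) powr p * a)" if "0 < s" "s < 1" for s
  proof -
    have "J (s *\<^sub>R (inverse s *\<^sub>R v) + (1 - s) *\<^sub>R (inverse (1 - s) *\<^sub>R n))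
      \<le> ereal s * J (inverse s *\<^sub>R v) + ereal (1 - s) * J (inverse (1 - s) *\<^sub>R n)"
      using that by (intro J_convex) auto
    then show ?thesis
      using that assms by (simp add: J_scale real mult.assoc)
  qed
  have "((\<lambda>s. s * (inverse s) powr p * a) \<longlongrightarrow> 1 * (inverse 1) powr p * a) (at_left 1)"
    by (intro tendsto_intros) auto
  then have lim: "((\<lambda>s. ereal (s * (inverse s) powr p * a)) \<longlongrightarrow> J v) (at_left 1)"
    by (simp add: real)
  have "\<forall>\<^sub>F s::real in at_left 1. s \<in> {0<..<1}"
    by (rule eventually_at_left_real) simp
  then have "\<forall>\<^sub>F s in at_left 1. J (v + n) \<le> ereal (s * (inverse s) powr p * a)"
    by eventually_elim (auto intro: le)
  then show ?thesis
    by (rule tendsto_lowerbound[OF lim]) simp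
qed (use J_nonneg[of v] in auto)

lemma null_scale: "J n = 0 \<Longrightarrow> J (c *\<^sub>R n) = 0"
  by (cases "c = 0") (simp_all add: J_zero J_scale)

lemma J_diff_null:
  assumes "J n = 0"
  shows "J (v - n) = J v"
proof (rule antisym)
  show "J (v - n) \<le> J v"
    using J_add_null_le[of "- n" v] null_scale[OF assms, of "-1"] by simp
  show "J v \<le> J (v - n)"
    using J_add_null_le[OF assms, of "v - n"] by simp
qed

lemma subgradient_finite:
  assumes "\<zeta> \<in> subdifferential J v"
  shows "J v = ereal (real_of_ereal (J v))"
proof -
  have "J v + ereal (\<zeta> \<bullet> (0 - v)) \<le> J 0"
    using assms unfolding subdifferential_def by blast
  then show ?thesis
    using J_nonneg[of v] by (cases "J v") (auto simp: J_zero)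
qed

lemma subgradient_orthogonal_null:
  assumes "\<zeta> \<in> subdifferential J v" and "J n = 0"
  shows "\<zeta> \<bullet> n = 0"
proof -
  have "\<zeta> \<bullet> (c *\<^sub>R n) \<le> 0" for c
  proof -
    have "J v + ereal (\<zeta> \<bullet> (v + c *\<^sub>R n - v)) \<le> J (v + c *\<^sub>R n)"
      using assms(1) unfolding subdifferential_def by blast
    also have "\<dots> \<le> J v"
      using assms(2) by (intro J_add_null_le null_scale)
    finally show ?thesis
      by (subst (asm) (1 2) subgradient_finite[OF assms(1)]) simp
  qed
  from this[of 1] this[of "-1"] show ?thesis by simp
qed

text \<open>
  Near \<open>c = 1\<close> the function \<open>c \<mapsto> J (c *\<^sub>R v) - J v - (c - 1) * (\<zeta> \<bullet> v)\<close> is nonnegative and vanishes at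
  \<open>c = 1\<close>, so its derivative \<open>p * J v - \<zeta> \<bullet> v\<close> vanishes there.
\<close>

lemma subgradient_euler:
  assumes "\<zeta> \<in> subdifferential J v"
  shows "\<zeta> \<bullet> v = p * real_of_ereal (J v)"
proof -
  define a where "a = real_of_ereal (J v)"
  have a: "J v = ereal a"
    using subgradient_finite[OF assms] by (simp add: a_def)
  define g where "g c = c powr p * a - a - (c - 1) * (\<zeta> \<bullet> v)" for c
  have "g 1 \<le> g c" if "\<bar>1 - c\<bar> < 1" for c
  proof -
    have "0 < c" using that by simp
    have "J v + ereal (\<zeta> \<bullet> (c *\<^sub>R v - v)) \<le> J (c *\<^sub>R v)"
      using assms unfolding subdifferential_def by blast
    then show ?thesis
      using \<open>0 < c\<close> by (simp add: J_scale a g_def algebra_simps)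
  qed
  moreover have "(g has_real_derivative p * a - \<zeta> \<bullet> v) (at 1)"
    unfolding g_def by (auto intro!: derivative_eq_intros)
  ultimately have "p * a - \<zeta> \<bullet> v = 0"
    by (intro DERIV_local_min[of g _ 1 1]) auto
  then show ?thesis by (simp add: a_def)
qed

end

section \<open>Subgradient flows\<close>

locale subgradient_flow = homogeneous_convex J p
  for J :: "'a::real_inner \<Rightarrow> ereal" and p :: real +
  fixes u \<zeta> :: "real \<Rightarrow> 'a"
  assumes p_ge: "1 \<le> p"
    and deriv: "0 < t \<Longrightarrow> (u has_vector_derivative - \<zeta> t) (at_right t)"
    and subgrad: "0 < t \<Longrightarrow> \<zeta> t \<in> subdifferential J (u t)"
    and lipschitz: "0 < \<delta> \<Longrightarrow> \<exists>L. lipschitz_on L {\<delta>..} u"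
begin

definition j :: "real \<Rightarrow> real" where
  "j t = real_of_ereal (J (u t))"

lemma J_eq_j: "0 < t \<Longrightarrow> J (u t) = ereal (j t)"
  using subgradient_finite[OF subgrad] by (simp add: j_def)

lemma j_nonneg: "0 \<le> j t"
  using J_nonneg by (simp add: j_def real_of_ereal_pos)

lemma subgrad_le: "0 < s \<Longrightarrow> 0 < t \<Longrightarrow> j t + \<zeta> t \<bullet> (u s - u t) \<le> j s"
  using subgrad[of t] J_eq_j[of s] J_eq_j[of t]
  unfolding subdifferential_def by (metis (mono_tags, lifting) mem_Collect_eq plus_ereal.simps(1) ereal_less_eq(3))

lemma euler: "0 < t \<Longrightarrow> \<zeta> t \<bullet> u t = p * j t"
  using subgradient_euler[OF subgrad] by (simp add: j_def)

lemma continuous_on_u: "0 < a \<Longrightarrow> continuous_on {a..} u"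
  using lipschitz lipschitz_on_continuous_on by blast

lemma difference_quotient_norm:
  assumes "0 < t"
  shows "((\<lambda>s. norm (u s - u t) / (s - t)) \<longlongrightarrow> norm (\<zeta> t)) (at_right t)"
proof -
  have "((\<lambda>s. (u s - u t - (s - t) *\<^sub>R (- \<zeta> t)) /\<^sub>R norm (s - t)) \<longlongrightarrow> 0) (at_right t)"
    using deriv[OF assms] by (simp add: has_vector_derivative_def has_derivative_at_within)
  moreover have "\<forall>\<^sub>F s in at_right t.
      (u s - u t - (s - t) *\<^sub>R (- \<zeta> t)) /\<^sub>R norm (s - t) = (u s - u t) /\<^sub>R (s - t) - (- \<zeta> t)"
    using eventually_at_right_less[of t] by eventually_elim (simp add: scaleR_add_right)
  ultimately have "((\<lambda>s. (u s - u t) /\<^sub>R (s - t) - (- \<zeta> t)) \<longlongrightarrow> 0) (at_right t)"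
    by (rule Lim_transform_eventually)
  then have "((\<lambda>s. (u s - u t) /\<^sub>R (s - t)) \<longlongrightarrow> - \<zeta> t) (at_right t)"
    by (rule Lim_null[THEN iffD2])
  from tendsto_norm[OF this]
  have "((\<lambda>s. norm ((u s - u t) /\<^sub>R (s - t))) \<longlongrightarrow> norm (\<zeta> t)) (at_right t)"
    by simp
  moreover have "\<forall>\<^sub>F s in at_right t. norm ((u s - u t) /\<^sub>R (s - t)) = norm (u s - u t) / (s - t)"
    using eventually_at_right_less[of t] by eventually_elim (simp add: divide_inverse mult.commute)
  ultimately show ?thesis
    by (rule Lim_transform_eventually)
qed

lemma continuous_on_j:
  assumes "0 < a"
  shows "continuous_on {a..} j"
proof -
  obtain L where L: "lipschitz_on L {a..} u"
    using lipschitz[OF assms] by blast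
  \<comment> \<open>A Lipschitz constant of \<open>u\<close> bounds the norms of the \<open>\<zeta> t\<close>, and these norms control the increments of
    the energy from both sides.\<close>
  have zeta: "norm (\<zeta> t) \<le> L" if "a \<le> t" for t
  proof (rule tendsto_upperbound[OF difference_quotient_norm])
    show "0 < t" using assms that by simp
    show "\<forall>\<^sub>F s in at_right t. norm (u s - u t) / (s - t) \<le> L"
      using eventually_at_right_less[of t]
    proof eventually_elim
      case (elim s)
      then show ?case
        using lipschitz_onD[OF L, of s t] that by (simp add: dist_norm field_simps)
    qed
  qed simp
  have le: "j t - j s \<le> L * (L * \<bar>s - t\<bar>)" if "a \<le> s" "a \<le> t" for s t
  proof -
    have "j t - j s \<le> \<zeta> t \<bullet> (u t - u s)"
      using subgrad_le[of s t] assms that by (simp add: inner_diff_right)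
    also have "\<dots> \<le> norm (\<zeta> t) * norm (u t - u s)"
      by (rule norm_cauchy_schwarz)
    also have "\<dots> \<le> L * (L * \<bar>s - t\<bar>)"
      using lipschitz_onD[OF L, of t s] that lipschitz_on_nonneg[OF L]
      by (intro mult_mono zeta) (auto simp: dist_norm abs_minus_commute)
    finally show ?thesis .
  qed
  have "lipschitz_on (L * L) {a..} j"
  proof (rule lipschitz_onI)
    fix s t assume "s \<in> {a..}" "t \<in> {a..}"
    then show "dist (j s) (j t) \<le> L * L * dist s t"
      using le[of s t] le[of t s] by (auto simp: dist_real_def abs_le_iff abs_minus_commute mult.assoc)
  qed simp
  then show ?thesis
    by (rule lipschitz_on_continuous_on)
qed

text \<open>
  If the energy dropped more slowly than at the rate \<open>c < (norm (\<zeta> t))\<^sup>2\<close> on an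
  interval to the right of \<open>t\<close>, then \<open>(norm (u s - u t))\<^sup>2\<close>, whose right derivative is at most
  \<open>2 * (j t - j s)\<close> by the subgradient inequality, would be bounded by \<open>c * (s - t)\<^sup>2\<close>. This
  contradicts the value of the right derivative of \<open>u\<close> at \<open>t\<close>.
\<close>

lemma frequently_energy_decay:
  assumes "0 < t" and c: "c < (norm (\<zeta> t))\<^sup>2"
  shows "\<exists>\<^sub>F s in at_right t. j s \<le> j t - c * (s - t)"
proof (rule ccontr)
  assume "\<not> ?thesis"
  then have "\<forall>\<^sub>F s in at_right t. j t - c * (s - t) < j s"
    by (simp add: not_frequently not_le)
  then obtain b where "t < b" and slow: "\<And>s. t < s \<Longrightarrow> s < b \<Longrightarrow> j t - c * (s - t) < j s"
    by (auto simp: eventually_at_right_field)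
  define q where "q s = (norm (u s - u t))\<^sup>2 - c * (s - t)\<^sup>2" for s
  have q: "q s \<le> q t" if "t < s" "s < b" for s
  proof (rule right_derivative_antimono[of t s q])
    show "continuous_on {t..s} q"
      unfolding q_def
      by (intro continuous_intros continuous_on_subset[OF continuous_on_u[OF assms(1)]]) auto
    fix x assume x: "t \<le> x" "x < s"
    have "(q has_real_derivative 2 * (- \<zeta> x \<bullet> (u x - u t)) - c * (2 * (x - t))) (at_right x)"
      unfolding q_def using assms(1) x
      by (intro DERIV_diff has_real_derivative_norm_sq_diff deriv)
        (auto intro!: derivative_eq_intros)
    moreover have "2 * (- \<zeta> x \<bullet> (u x - u t)) - c * (2 * (x - t)) \<le> 0"
    proof -
      have "- \<zeta> x \<bullet> (u x - u t) \<le> j t - j x"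
        using subgrad_le[of t x] assms(1) x by (simp add: inner_diff_right)
      moreover have "j t - j x \<le> c * (x - t)"
        using slow[of x] x that by (cases "x = t") auto
      ultimately have "- \<zeta> x \<bullet> (u x - u t) \<le> c * (x - t)"
        by (rule order_trans)
      moreover have "c * (2 * (x - t)) = 2 * (c * (x - t))"
        by (rule mult.left_commute)
      ultimately show ?thesis by linarith
    qed
    ultimately show "\<exists>D\<le>0. (q has_real_derivative D) (at_right x)"
      by blast
  qed (use that in simp)
  have "(norm (\<zeta> t))\<^sup>2 \<le> c"
  proof (rule tendsto_upperbound[OF tendsto_power[OF difference_quotient_norm[OF assms(1)]]])
    have "\<forall>\<^sub>F s in at_right t. s \<in> {t<..<b}"
      using \<open>t < b\<close> by (rule eventually_at_right_real)
    then show "\<forall>\<^sub>F s in at_right t. (norm (u s - u t) / (s - t))\<^sup>2 \<le> c"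
    proof eventually_elim
      case (elim s)
      then show ?case
        using q[of s] by (simp add: q_def power_divide divide_le_eq)
    qed
  qed simp
  with c show False by simp
qed

text \<open>Both signs of the factor \<open>k\<close> are used, to get equality from a monotonicity principle.\<close>

lemma inner_null_constant:
  assumes "0 < s" "s \<le> t" "J n = 0"
  shows "u t \<bullet> n = u s \<bullet> n"
proof -
  have "k * (u t \<bullet> n) \<le> k * (u s \<bullet> n)" for k :: real
  proof (rule right_derivative_antimono[OF assms(2)])
    show "continuous_on {s..t} (\<lambda>x. k * (u x \<bullet> n))"
      using assms(1) by (intro continuous_intros continuous_on_subset[OF continuous_on_u]) auto
    fix x assume "s \<le> x"
    then have x: "0 < x" using assms(1) by simp
    have "((\<lambda>y. u y \<bullet> n) has_vector_derivative - \<zeta> x \<bullet> n) (at_right x)"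
      by (rule bounded_linear.has_vector_derivative[OF bounded_linear_inner_left deriv[OF x]])
    then have "((\<lambda>y. k * (u y \<bullet> n)) has_real_derivative k * (- \<zeta> x \<bullet> n)) (at_right x)"
      unfolding has_real_derivative_iff_has_vector_derivative[symmetric] by (rule DERIV_cmult)
    moreover have "- \<zeta> x \<bullet> n = 0"
      using subgradient_orthogonal_null[OF subgrad[OF x] assms(3)] by simp
    ultimately show "\<exists>D\<le>0. ((\<lambda>y. k * (u y \<bullet> n)) has_real_derivative D) (at_right x)"
      by auto
  qed
  from this[of 1] this[of "-1"] show ?thesis by simp
qed

lemma norm_sq_deriv:
  assumes "0 < t"
  shows "((\<lambda>s. (norm (u s))\<^sup>2) has_real_derivative - 2 * (p * j t)) (at_right t)"
  using has_real_derivative_norm_sq_diff[OF deriv[OF assms], of 0] euler[OF assms] by simp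

lemma norm_antimono:
  assumes "0 < s" "s \<le> t"
  shows "(norm (u t))\<^sup>2 \<le> (norm (u s))\<^sup>2"
proof (rule right_derivative_antimono[OF assms(2)])
  show "continuous_on {s..t} (\<lambda>x. (norm (u x))\<^sup>2)"
    using assms(1) by (intro continuous_intros continuous_on_subset[OF continuous_on_u]) auto
  fix x assume "s \<le> x"
  then show "\<exists>D\<le>0. ((\<lambda>x. (norm (u x))\<^sup>2) has_real_derivative D) (at_right x)"
    using assms(1) p_ge j_nonneg[of x] by (intro exI[of _ "- 2 * (p * j x)"] conjI norm_sq_deriv) auto
qed

text \<open>
  The norm decreases along the flow, strictly where the energy is positive. If the flow passes through its own limit, then the norm
  has reached its limit as well and stays constant from then on, which leaves no energy.
\<close>

lemma limit_attained_null:
  assumes "0 < T" and lim: "(u \<longlongrightarrow> u T) at_top"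
  shows "J (u T) = 0"
proof -
  have "j T = 0"
  proof (rule ccontr)
    assume "j T \<noteq> 0"
    then have pos: "0 < p * j T"
      using j_nonneg[of T] p_ge by simp
    have "\<forall>\<^sub>F s in at_right T. (norm (u s))\<^sup>2 \<le> (norm (u T))\<^sup>2 + (- (p * j T)) * (s - T)"
      using pos by (intro eventually_right_derivative_bound[OF norm_sq_deriv[OF \<open>0 < T\<close>]]) simp
    with eventually_at_right_less[of T]
    have "\<forall>\<^sub>F s in at_right T. T < s \<and> (norm (u s))\<^sup>2 < (norm (u T))\<^sup>2"
    proof eventually_elim
      case (elim s)
      then have "0 < p * j T * (s - T)" using pos by simp
      with elim show ?case by simp
    qed
    then obtain s where s: "T < s" "(norm (u s))\<^sup>2 < (norm (u T))\<^sup>2"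
      using eventually_happens'[OF trivial_limit_at_right_real] by blast
    have "((\<lambda>t. (norm (u t))\<^sup>2) \<longlongrightarrow> (norm (u T))\<^sup>2) at_top"
      by (intro tendsto_intros lim)
    moreover have "\<forall>\<^sub>F t in at_top. (norm (u t))\<^sup>2 \<le> (norm (u s))\<^sup>2"
      using eventually_ge_at_top[of s] by eventually_elim (use s \<open>0 < T\<close> norm_antimono in auto)
    ultimately have "(norm (u T))\<^sup>2 \<le> (norm (u s))\<^sup>2"
      by (rule tendsto_upperbound) simp
    with s show False by simp
  qed
  then show ?thesis
    using J_eq_j[OF \<open>0 < T\<close>] by simp
qed

text \<open>
  A null vector \<open>y\<close> is orthogonal to every \<open>\<zeta> t\<close>, so Euler's identity also computes the right
  derivative of the distance to \<open>y\<close>.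
\<close>

lemma distance_powr_deriv:
  assumes "0 < t" "J y = 0" "u t \<noteq> y"
  shows "((\<lambda>s. norm (u s - y) powr a) has_real_derivative
    - (a * norm (u t - y) powr (a - 2) * (p * j t))) (at_right t)"
proof -
  have "\<zeta> t \<bullet> (u t - y) = p * j t"
    using euler[OF assms(1)] subgradient_orthogonal_null[OF subgrad[OF assms(1)] assms(2)]
    by (simp add: inner_diff_right)
  then show ?thesis
    using has_real_derivative_norm_diff_powr[OF deriv[OF assms(1)] assms(3), of a] by simp
qed

definition rayleigh :: "'a \<Rightarrow> real \<Rightarrow> real" where
  "rayleigh y t = p * j t * norm (u t - y) powr (- p)"

text \<open>
  Along times decreasing to \<open>t\<close> the energy decays at a rate arbitrarily close to \<open>(norm (\<zeta> t))\<^sup>2\<close> or faster, and the right derivative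
  of \<open>norm (u t - y) powr (- p)\<close> is \<open>p * (p * j t) * norm (u t - y) powr (- p - 2)\<close>. Since
  \<open>p * j t = \<zeta> t \<bullet> (u t - y)\<close>, the two contributions to the change of the Rayleigh quotient are
  compared by the Cauchy--Schwarz inequality.
\<close>

lemma rayleigh_antimono:
  assumes "0 < t" "t \<le> s" and y: "J y = 0" and ne: "\<And>x. t \<le> x \<Longrightarrow> x \<le> s \<Longrightarrow> u x \<noteq> y"
  shows "rayleigh y s \<le> rayleigh y t"
proof -
  define g where "g x = norm (u x - y) powr (- p)" for x
  have "j s * g s \<le> j t * g t"
  proof (rule dini_antimono[OF assms(2)])
    show "continuous_on {t..s} (\<lambda>x. j x * g x)"
      unfolding g_def using assms(1) ne
      by (intro continuous_intros continuous_on_subset[OF continuous_on_u]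
          continuous_on_subset[OF continuous_on_j]) auto
    fix x \<epsilon> :: real assume x: "t \<le> x" "x < s" and "0 < \<epsilon>"
    then have "0 < x" and ux: "u x \<noteq> y"
      using assms(1) ne[of x] by auto
    define m where "m = (norm (\<zeta> x))\<^sup>2"
    define d where "d = p * norm (u x - y) powr (- p - 2) * (p * j x)"
    have "0 \<le> g x" by (simp add: g_def)
    \<comment> \<open>The three errors below, from the decay rate of \<open>j\<close>, from the limit of \<open>g\<close> and from the
      derivative of \<open>g\<close>, add up to \<open>\<delta>\<close> times this denominator.\<close>
    define \<delta> where "\<delta> = \<epsilon> / (g x + 1 + j x)"
    have "0 < \<delta>" and delta: "\<delta> * (g x + 1 + j x) = \<epsilon>"
      using \<open>0 < \<epsilon>\<close> \<open>0 \<le> g x\<close> j_nonneg[of x] by (auto simp: \<delta>_def)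
    have cs: "j x * d \<le> m * g x"
    proof -
      have "p * j x = \<zeta> x \<bullet> (u x - y)"
        using euler[OF \<open>0 < x\<close>] subgradient_orthogonal_null[OF subgrad[OF \<open>0 < x\<close>] y]
        by (simp add: inner_diff_right)
      also have "\<dots> \<le> norm (\<zeta> x) * norm (u x - y)"
        by (rule norm_cauchy_schwarz)
      finally have "(p * j x)\<^sup>2 \<le> (norm (\<zeta> x) * norm (u x - y))\<^sup>2"
        using j_nonneg[of x] p_ge by (intro power_mono) auto
      then have "norm (u x - y) powr (- p - 2) * (p * j x)\<^sup>2
          \<le> norm (u x - y) powr (- p - 2) * (m * (norm (u x - y))\<^sup>2)"
        by (intro mult_left_mono) (auto simp: m_def power_mult_distrib)
      also have "\<dots> = m * (norm (u x - y) powr (- p - 2) * norm (u x - y) powr 2)"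
        using ux by simp
      also have "norm (u x - y) powr (- p - 2) * norm (u x - y) powr 2
          = norm (u x - y) powr (- p - 2 + 2)"
        by (rule powr_add[symmetric])
      also have "- p - 2 + 2 = - p"
        by simp
      also have "m * norm (u x - y) powr (- p) = m * g x"
        by (simp add: g_def)
      finally show ?thesis
        by (simp add: d_def power2_eq_square mult_ac)
    qed
    have g: "(g has_real_derivative d) (at_right x)"
      unfolding g_def d_def using distance_powr_deriv[OF \<open>0 < x\<close> y ux, of "- p"] by simp
    have "(g \<longlongrightarrow> g x) (at_right x)"
      using DERIV_continuous[OF g] by (simp add: continuous_within)
    then have "((\<lambda>s. (m - \<delta>) * g s) \<longlongrightarrow> (m - \<delta>) * g x) (at_right x)"
      by (intro tendsto_intros)
    then have "\<forall>\<^sub>F s in at_right x. (m - \<delta>) * g x - \<delta> < (m - \<delta>) * g s"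
      using \<open>0 < \<delta>\<close> by (intro order_tendstoD(1)) auto
    moreover have "\<forall>\<^sub>F s in at_right x. g s \<le> g x + (d + \<delta>) * (s - x)"
      using \<open>0 < \<delta>\<close> by (intro eventually_right_derivative_bound[OF g]) simp
    moreover note eventually_at_right_less[of x]
    ultimately have ev: "\<forall>\<^sub>F s in at_right x. j s \<le> j x - (m - \<delta>) * (s - x) \<longrightarrow>
        j s * g s \<le> j x * g x + \<epsilon> * (s - x)"
    proof eventually_elim
      case (elim s)
      show ?case
      proof
        assume j: "j s \<le> j x - (m - \<delta>) * (s - x)"
        have "0 \<le> g s" by (simp add: g_def)
        have "j s * g s \<le> (j x - (m - \<delta>) * (s - x)) * g s"
          using j \<open>0 \<le> g s\<close> by (rule mult_right_mono)
        also have "\<dots> = j x * g s - ((m - \<delta>) * g s) * (s - x)"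
          by (simp add: algebra_simps)
        also have "\<dots> \<le> j x * (g x + (d + \<delta>) * (s - x)) - ((m - \<delta>) * g x - \<delta>) * (s - x)"
          using elim j_nonneg[of x] by (intro diff_mono mult_left_mono mult_right_mono) auto
        also have "\<dots> = j x * g x + (j x * d - m * g x + \<delta> * (g x + 1 + j x)) * (s - x)"
          by (simp add: algebra_simps)
        also have "\<dots> \<le> j x * g x + \<epsilon> * (s - x)"
          using cs elim unfolding delta by (intro add_left_mono mult_right_mono) auto
        finally show "j s * g s \<le> j x * g x + \<epsilon> * (s - x)" .
      qed
    qed
    have "\<exists>\<^sub>F s in at_right x. j s \<le> j x - (m - \<delta>) * (s - x)"
      using \<open>0 < \<delta>\<close> by (intro frequently_energy_decay[OF \<open>0 < x\<close>]) (simp add: m_def)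
    then show "\<exists>\<^sub>F s in at_right x. j s * g s \<le> j x * g x + \<epsilon> * (s - x)"
      using ev by (rule frequently_rev_mp)
  qed
  then show ?thesis
    using p_ge by (simp add: rayleigh_def g_def mult.assoc)
qed

lemma continuous_on_distance_powr:
  assumes "0 < t" "p < 2"
  shows "continuous_on {t..} (\<lambda>s. norm (u s - y) powr (2 - p))"
  using assms by (intro continuous_on_powr' continuous_intros continuous_on_u) auto

text \<open>
  The exponent \<open>2 - p\<close> is the one for which the speed of decay is a constant multiple of the Rayleigh quotient;
  bounds on the quotient therefore integrate to bounds on this power of the distance.
\<close>

lemma distance_powr_deriv_rayleigh:
  assumes "0 < t" "J y = 0" "u t \<noteq> y"
  shows "((\<lambda>s. norm (u s - y) powr (2 - p)) has_real_derivative - ((2 - p) * rayleigh y t)) (at_right t)"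
  using distance_powr_deriv[OF assms, of "2 - p"] by (simp add: rayleigh_def mult_ac)

lemma extinction_lower_bound:
  assumes "0 < t" "t \<le> T" "p < 2" and y: "J y = 0" "u T = y"
    and ne: "\<And>x. t \<le> x \<Longrightarrow> x < T \<Longrightarrow> u x \<noteq> y"
    and K: "\<And>x. t \<le> x \<Longrightarrow> x < T \<Longrightarrow> K \<le> rayleigh y x"
  shows "(2 - p) * K * (T - t) \<le> norm (u t - y) powr (2 - p)"
proof -
  let ?h = "\<lambda>s. norm (u s - y) powr (2 - p) + (2 - p) * K * s"
  have "?h T \<le> ?h t"
  proof (rule right_derivative_antimono[OF assms(2)])
    show "continuous_on {t..T} ?h"
      using assms(1,3) by (intro continuous_intros
        continuous_on_subset[OF continuous_on_distance_powr]) auto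
    fix x assume x: "t \<le> x" "x < T"
    have "(?h has_real_derivative - ((2 - p) * rayleigh y x) + (2 - p) * K) (at_right x)"
      using x assms(1) ne y
      by (intro DERIV_add distance_powr_deriv_rayleigh) (auto intro!: derivative_eq_intros)
    moreover have "- ((2 - p) * rayleigh y x) + (2 - p) * K \<le> 0"
      using K[OF x] assms(3) by simp
    ultimately show "\<exists>D\<le>0. (?h has_real_derivative D) (at_right x)" by blast
  qed
  then show ?thesis
    by (simp add: y algebra_simps)
qed

lemma extinction_upper_bound:
  assumes "0 < t" "t \<le> T" "p < 2" and y: "J y = 0" "u T = y"
    and ne: "\<And>x. t \<le> x \<Longrightarrow> x < T \<Longrightarrow> u x \<noteq> y"
    and K: "\<And>x. t \<le> x \<Longrightarrow> x < T \<Longrightarrow> rayleigh y x \<le> K"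
  shows "norm (u t - y) powr (2 - p) \<le> (2 - p) * K * (T - t)"
proof -
  let ?h = "\<lambda>s. - (norm (u s - y) powr (2 - p)) - (2 - p) * K * s"
  have "?h T \<le> ?h t"
  proof (rule right_derivative_antimono[OF assms(2)])
    show "continuous_on {t..T} ?h"
      using assms(1,3) by (intro continuous_intros
        continuous_on_subset[OF continuous_on_distance_powr]) auto
    fix x assume x: "t \<le> x" "x < T"
    have "(?h has_real_derivative - (- ((2 - p) * rayleigh y x)) - (2 - p) * K) (at_right x)"
      using x assms(1) ne y
      by (intro DERIV_diff DERIV_minus distance_powr_deriv_rayleigh)
        (auto intro!: derivative_eq_intros)
    moreover have "- (- ((2 - p) * rayleigh y x)) - (2 - p) * K \<le> 0"
      using K[OF x] assms(3) by simp
    ultimately show "\<exists>D\<le>0. (?h has_real_derivative D) (at_right x)" by blast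
  qed
  then show ?thesis
    by (simp add: y algebra_simps)
qed

text \<open>
  The inner product of the flow with a null vector is constant, so \<open>u t - u T\<close> is orthogonal to the
  null space and competes in the infimum defining \<open>\<lambda>\<^sub>1\<close>.
\<close>

lemma lambda1_le_rayleigh:
  assumes "0 < t" "t \<le> T" and y: "J y = 0" "u T = y" "u t \<noteq> y"
  shows "lambda1 p J \<le> ereal (rayleigh y t)"
proof -
  have "u t - y \<in> (null_space_of J)\<^sup>\<bottom> - {0}"
    using inner_null_constant[OF assms(1,2)] y
    by (auto simp: orthogonal_comp_def orthogonal_def null_space_of_def inner_diff_right
        inner_commute)
  then have "lambda1 p J \<le> ereal p * J (u t - y) / ereal (norm (u t - y) powr p)"
    unfolding lambda1_def by (rule INF_lower)
  also have "\<dots> = ereal (rayleigh y t)"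
    using y by (simp add: J_diff_null J_eq_j[OF assms(1)] rayleigh_def powr_minus divide_inverse)
  finally show ?thesis .
qed

lemma upper_Lambda_eq_rayleigh:
  assumes "0 < t" "u t \<noteq> y"
  shows "upper_Lambda p J u y t = ereal (rayleigh y t)"
  using assms by (simp add: upper_Lambda_def J_eq_j rayleigh_def powr_minus divide_inverse)

end

section \<open>The extinction time\<close>

lemma not_extinct_before:
  assumes "0 < t" "ereal t < extinction_time u y"
  shows "u t \<noteq> y"
proof
  assume "u t = y"
  with \<open>0 < t\<close> have "extinction_time u y \<le> ereal t"
    unfolding extinction_time_def by (intro INF_lower) simp
  with assms(2) show False by simp
qed

lemma extinct_at_extinction_time:
  fixes u :: "real \<Rightarrow> 'a::t1_space"
  assumes cont: "continuous_on {0..} u" and "0 < T" and T: "extinction_time u y = ereal T"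
  shows "u T = y"
proof (rule ccontr)
  assume ne: "u T \<noteq> y"
  have "(u \<longlongrightarrow> u T) (at T within {0..})"
    using cont \<open>0 < T\<close> by (auto simp: continuous_on_def)
  then have "(u \<longlongrightarrow> u T) (at_right T)"
    by (rule tendsto_within_subset) (use \<open>0 < T\<close> in auto)
  then have "\<forall>\<^sub>F s in at_right T. u s \<noteq> y"
    using ne by (rule tendsto_imp_eventually_ne)
  then obtain b where "T < b" and b: "\<And>s. T < s \<Longrightarrow> s < b \<Longrightarrow> u s \<noteq> y"
    by (auto simp: eventually_at_right_field)
  have "ereal b \<le> extinction_time u y"
    unfolding extinction_time_def
  proof (rule INF_greatest)
    fix s assume s: "s \<in> {t. 0 < t \<and> u t = y}"
    then have "\<not> ereal s < ereal T"
      using not_extinct_before[of s u y] T by auto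
    moreover have "s \<noteq> T"
      using s ne by auto
    ultimately have "T < s" by simp
    then show "ereal b \<le> ereal s"
      using s b[of s] by (auto simp flip: not_less)
  qed
  with T \<open>T < b\<close> show False by simp
qed

theorem proposition2p68:
  fixes J :: "'a::{real_inner, complete_space} \<Rightarrow> ereal"
    and p :: real and f u_inf :: 'a and u :: "real \<Rightarrow> 'a"
  assumes "1 \<le> p" and "p < 2"
    and "abs_homogeneous p J"
    and "proper_functional J"
    and "convex_functional J"
    and "lsc_functional J"
    and "f \<in> closure (effective_dom J)"
    and "is_gradient_flow J f u"
    and "(u \<longlongrightarrow> u_inf) at_top"
    and "extinction_time u u_inf < \<infinity>"
  shows "\<forall>t>0. ereal t < extinction_time u u_inf \<longrightarrow>
      ereal (2 - p) * lambda1 p J * (extinction_time u u_inf - ereal t)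
        \<le> ereal (norm (u t - u_inf) powr (2 - p)) \<and>
      ereal (norm (u t - u_inf) powr (2 - p))
        \<le> ereal (2 - p) * upper_Lambda p J u u_inf t * (extinction_time u u_inf - ereal t)"
proof (intro allI impI)
  fix t :: real assume "0 < t" and t: "ereal t < extinction_time u u_inf"
  note flow = assms(8)[unfolded is_gradient_flow_def]
  have "\<forall>t. \<exists>z. 0 < t \<longrightarrow>
      (u has_vector_derivative - z) (at_right t) \<and> z \<in> subdifferential J (u t)"
    using flow unfolding is_min_norm_element_def by (metis minus_minus)
  then obtain \<zeta> where "\<And>t. 0 < t \<Longrightarrow>
      (u has_vector_derivative - \<zeta> t) (at_right t) \<and> \<zeta> t \<in> subdifferential J (u t)"
    by metis
  then interpret subgradient_flow J p u \<zeta>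
    using assms(1,3,5) flow by unfold_locales auto
  obtain T where T: "extinction_time u u_inf = ereal T" and "t < T"
    using t assms(10) by (cases "extinction_time u u_inf") auto
  then have "0 < T" using \<open>0 < t\<close> by simp
  have uT: "u T = u_inf"
    using flow T \<open>0 < T\<close> by (blast intro: extinct_at_extinction_time)
  have null: "J u_inf = 0"
    using limit_attained_null[OF \<open>0 < T\<close>] assms(9) uT by simp
  have ne: "u x \<noteq> u_inf" if "t \<le> x" "x < T" for x
    using that \<open>0 < t\<close> by (intro not_extinct_before) (auto simp: T)
  have "ereal (2 - p) * lambda1 p J * (ereal T - ereal t)
      \<le> ereal (norm (u t - u_inf) powr (2 - p))"
  proof (cases "lambda1 p J")
    case (real l)
    have "l \<le> rayleigh u_inf x" if "t \<le> x" "x < T" for x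
      using lambda1_le_rayleigh[of x T u_inf] real null uT ne[OF that] that \<open>0 < t\<close> by simp
    then have "(2 - p) * l * (T - t) \<le> norm (u t - u_inf) powr (2 - p)"
      using \<open>0 < t\<close> \<open>t < T\<close> \<open>p < 2\<close> null uT ne by (intro extinction_lower_bound) auto
    then show ?thesis by (simp add: real)
  next
    case PInf
    then show ?thesis
      using lambda1_le_rayleigh[of t T u_inf] null uT ne[of t] \<open>0 < t\<close> \<open>t < T\<close> by simp
  next
    case MInf
    then show ?thesis
      using \<open>t < T\<close> \<open>p < 2\<close> by simp
  qed
  moreover have "rayleigh u_inf x \<le> rayleigh u_inf t" if "t \<le> x" "x < T" for x
    using that \<open>0 < t\<close> null ne by (intro rayleigh_antimono) auto
  then have "norm (u t - u_inf) powr (2 - p) \<le> (2 - p) * rayleigh u_inf t * (T - t)"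
    using \<open>0 < t\<close> \<open>t < T\<close> \<open>p < 2\<close> null uT ne by (intro extinction_upper_bound) auto
  then have "ereal (norm (u t - u_inf) powr (2 - p))
      \<le> ereal (2 - p) * upper_Lambda p J u u_inf t * (ereal T - ereal t)"
    using ne[of t] \<open>0 < t\<close> \<open>t < T\<close> by (simp add: upper_Lambda_eq_rayleigh)
  ultimately show "ereal (2 - p) * lambda1 p J * (extinction_time u u_inf - ereal t)
        \<le> ereal (norm (u t - u_inf) powr (2 - p)) \<and>
      ereal (norm (u t - u_inf) powr (2 - p))
        \<le> ereal (2 - p) * upper_Lambda p J u u_inf t * (extinction_time u u_inf - ereal t)"
    by (simp add: T)
qed

end
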